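(* Let $p\in(0,1]$ and let $\phi\in L^\infty(\mathbb{R}^d)$ with $P|\phi|\in L^\infty(\mathbb{R}^d)$. Then for each $j>0$, the analysis operator $T_j:L^p(\mathbb{R}^d)\to\ell^p(\mathbb{Z}^d)$ is locally H\"older continuous, with $$d_{\ell^p}(T_jf,T_jg)\le C\,[d_p(f,0)+d_p(0,g)]^{1-p}\,d_p(f,g)^p,\qquad f,g\in L^p(\mathbb{R}^d).$$ Here $C$ depends on the translation matrix $b$, the exponent $p$ and the analyzer $\phi$, but not on the dilation scale $j$.
   Context: Fix a dimension $d\in\mathbb{N}$. Functions and sequences are complex valued. Fix invertible real $d\times d$ matrices $a_j$ (integers $j>0$) with $\|a_j^{-1}\|\to0$ as $j\to\infty$ (operator norm), and an invertible real $d\times d$ matrix $b$ (the translation matrix). $\|f\|_p=(\int_{\mathbb{R}^d}|f|^p\,dx)^{1/p}$ and $d_p(f,g)=\|f-g\|_p^p$ on $L^p(\mathbb{R}^d)$; $\|s\|_{\ell^p(\mathbb{Z}^d)}=(\sum_{k\in\mathbb{Z}^d}|s_k|^p)^{1/p}$ and $d_{\ell^p}(s,t)=\|s-t\|_{\ell^p(\mathbb{Z}^d)}^p$ on $\ell^p(\mathbb{Z}^d)$. Radial stretch: $\Theta(z)=|z|^{p-1}z$ for $z\in\mathbb{C}$ (with $\Theta(0)=0$), a homeomorphism of $\mathbb{C}$; $(\Theta f)(x)=\Theta(f(x))$. If $f\in L^p$ then $\Theta f\in L^1$. Write $\langle F,G\rangle=\int_{\mathbb{R}^d}F\overline{G}\,dx$.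 Analysis operator at scale $j$ (nonlinear, with analyzer $\phi$): $T_jf=\{|\det b|\,\Theta^{-1}(\langle\Theta f,\phi(a_j\,\cdot-bk)\rangle)\}_{k\in\mathbb{Z}^d}$. Periodization: $Pg(x)=|\det b|\sum_{k\in\mathbb{Z}^d}g(x-bk)$. *)

theory Defs
  imports "HOL-Analysis.Analysis"
begin

definition Lp :: "real \<Rightarrow> (real^'d::finite \<Rightarrow> complex) set" where
  "Lp p = {f. f \<in> borel_measurable lebesgue \<and> integrable lebesgue (\<lambda>x. norm (f x) powr p)}"

definition Lp_norm :: "real \<Rightarrow> (real^'d::finite \<Rightarrow> complex) \<Rightarrow> real" where
  "Lp_norm p f = (LINT x|lebesgue. norm (f x) powr p) powr (1 / p)"

definition d_Lp :: "real \<Rightarrow> (real^'d::finite \<Rightarrow> complex) \<Rightarrow> (real^'d \<Rightarrow> complex) \<Rightarrow> real" where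
  "d_Lp p f g = Lp_norm p (\<lambda>x. f x - g x) powr p"

definition lp :: "real \<Rightarrow> (int^'d::finite \<Rightarrow> complex) set" where
  "lp p = {s. (\<lambda>k. norm (s k) powr p) summable_on UNIV}"

definition lp_norm :: "real \<Rightarrow> (int^'d::finite \<Rightarrow> complex) \<Rightarrow> real" where
  "lp_norm p s = (\<Sum>\<^sub>\<infinity>k. norm (s k) powr p) powr (1 / p)"

definition d_lp :: "real \<Rightarrow> (int^'d::finite \<Rightarrow> complex) \<Rightarrow> (int^'d \<Rightarrow> complex) \<Rightarrow> real" where
  "d_lp p s t = lp_norm p (\<lambda>k. s k - t k) powr p"

definition Linf :: "(real^'d::finite \<Rightarrow> complex) set" where
  "Linf = {g. g \<in> borel_measurable lebesgue \<and> (\<exists>M::real. AE x in lebesgue. norm (g x) \<le> M)}"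

text \<open>For extended nonnegative functions, membership includes finiteness almost everywhere.\<close>

definition Linf_ennreal :: "(real^'d::finite \<Rightarrow> ennreal) set" where
  "Linf_ennreal = {g. g \<in> borel_measurable lebesgue \<and> (\<exists>M::real. AE x in lebesgue. g x \<le> ennreal M)}"

text \<open>At \<open>z = 0\<close> the value is \<open>0\<close>, whatever the value of the factor \<open>0 powr (p - 1)\<close>.\<close>

definition radial_stretch :: "real \<Rightarrow> complex \<Rightarrow> complex" where
  "radial_stretch p z = of_real (norm z powr (p - 1)) * z"

text \<open>The stretch is a bijection, so \<open>inv (radial_stretch p)\<close> is its genuine inverse.\<close>

lemma bij_radial_stretch:
  assumes "0 < p"
  shows "bij (radial_stretch p)"
proof -
  have nrm: "norm (radial_stretch q z) = norm z powr q" for q z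
    by (cases "z = 0") (simp_all add: radial_stretch_def norm_mult norm_divide powr_diff)
  have inverse: "radial_stretch r (radial_stretch q z) = z" if "q * r = 1" for q r z
  proof (cases "z = 0")
    case False
    have "norm z powr (q * (r - 1)) * norm z powr (q - 1) = norm z powr (q * r - 1)"
      by (simp add: powr_add[symmetric] algebra_simps)
    also have "\<dots> = 1"
      using that False by simp
    finally have one: "complex_of_real (norm z powr (q * (r - 1))) * of_real (norm z powr (q - 1)) = 1"
      by (metis of_real_1 of_real_mult)
    have "radial_stretch r (radial_stretch q z)
        = of_real (norm z powr (q * (r - 1))) * radial_stretch q z"
      by (simp add: radial_stretch_def[of r] nrm powr_powr)
    also have "\<dots> = z"
      using one by (simp add: radial_stretch_def mult.assoc[symmetric])
    finally show ?thesis .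
  qed (simp add: radial_stretch_def)
  show ?thesis
    by (rule o_bij[of "radial_stretch (1 / p)"]) (use assms inverse in \<open>auto simp: fun_eq_iff\<close>)
qed

definition real_vec :: "int^'d \<Rightarrow> real^'d" where
  "real_vec k = (\<chi> i. real_of_int (k $ i))"

definition pairing :: "(real^'d::finite \<Rightarrow> complex) \<Rightarrow> (real^'d \<Rightarrow> complex) \<Rightarrow> complex" where
  "pairing F G = (LINT x|lebesgue. F x * cnj (G x))"

definition analysis_op ::
  "real \<Rightarrow> real^'d^'d \<Rightarrow> (real^'d::finite \<Rightarrow> complex) \<Rightarrow> real^'d^'d
    \<Rightarrow> (real^'d \<Rightarrow> complex) \<Rightarrow> int^'d \<Rightarrow> complex" where
  "analysis_op p b \<phi> A f =
    (\<lambda>k. of_real \<bar>det b\<bar> * inv (radial_stretch p)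
      (pairing (\<lambda>x. radial_stretch p (f x)) (\<lambda>x. \<phi> (A *v x - b *v real_vec k))))"

text \<open>Periodization of a nonnegative function. Taking values in \<^typ>\<open>ennreal\<close> keeps a divergent
  lattice sum equal to infinity, whereas a real-valued infinite sum would default to \<open>0\<close>.\<close>

definition periodization :: "real^'d^'d \<Rightarrow> (real^'d::finite \<Rightarrow> ennreal) \<Rightarrow> real^'d \<Rightarrow> ennreal" where
  "periodization b g x = ennreal \<bar>det b\<bar> * (\<Sum>\<^sub>\<infinity>k. g (x - b *v real_vec k))"

text \<open>Local Hoelder continuity with exponent \<open>\<alpha>\<close>, with respect to explicit distance functions:
  every point of \<open>S\<close> has a neighbourhood on which a Hoelder estimate holds.\<close>

definition locally_Hoelder_on ::
  "'a set \<Rightarrow> ('a \<Rightarrow> 'a \<Rightarrow> real) \<Rightarrow> ('b \<Rightarrow> 'b \<Rightarrow> real) \<Rightarrow> real \<Rightarrow> ('a \<Rightarrow> 'b) \<Rightarrow> bool" where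
  "locally_Hoelder_on S d d' \<alpha> T \<longleftrightarrow>
    (\<forall>h\<in>S. \<exists>r>0. \<exists>K. \<forall>f\<in>S. \<forall>g\<in>S. d h f < r \<longrightarrow> d h g < r \<longrightarrow> d' (T f) (T g) \<le> K * d f g powr \<alpha>)"

end

theory Submission imports Defs begin

text \<open>Write \<open>\<Theta>\<close> for the radial stretch, \<open>u\<close> and \<open>v\<close> for the coefficient sequences of
  \<open>\<Theta> f\<close> and \<open>\<Theta> g\<close>, and \<open>M\<close> for an almost everywhere bound on the lattice sum of \<open>\<bar>\<phi>\<bar>\<close>. Moving the sum
  over \<open>k\<close> inside the integral gives \<open>\<Sum>\<bar>u k\<bar> \<le> M * d_Lp p f 0\<close>, and the \<open>p\<close>-Hoelder continuity of
  \<open>\<Theta>\<close> gives \<open>\<Sum>\<bar>u k - v k\<bar> \<le> 4 * M * d_Lp p f g\<close>. No Jacobian of the dilation enters: only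
  that it preserves null sets, so \<open>M\<close> serves at every scale. The inverse stretch has exponent
  \<open>1 / p \<ge> 1\<close> and is Lipschitz up to a factor \<open>(\<bar>u k\<bar> + \<bar>v k\<bar>) powr (1 / p - 1)\<close>; raising this to the
  power \<open>p\<close> and using Hoelder's inequality with exponents \<open>1 / (1 - p)\<close> and \<open>1 / p\<close> separates the
  two sums.\<close>

section \<open>The radial stretch\<close>

lemma norm_radial_stretch: "norm (radial_stretch q z) = norm z powr q"
  by (cases "z = 0") (simp_all add: radial_stretch_def norm_mult norm_divide powr_diff)

lemma radial_stretch_0 [simp]: "radial_stretch q 0 = 0"
  by (simp add: radial_stretch_def)

lemma radial_stretch_inverse:
  assumes "q * r = 1"
  shows "radial_stretch r (radial_stretch q z) = z"
proof (cases "z = 0")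
  case False
  have "norm z powr (q * (r - 1)) * norm z powr (q - 1) = norm z powr (q * r - 1)"
    by (simp add: powr_add[symmetric] algebra_simps)
  also have "\<dots> = 1"
    using assms False by simp
  finally have one: "complex_of_real (norm z powr (q * (r - 1))) * of_real (norm z powr (q - 1)) = 1"
    by (metis of_real_1 of_real_mult)
  have "radial_stretch r (radial_stretch q z) = of_real (norm z powr (q * (r - 1))) * radial_stretch q z"
    by (simp add: radial_stretch_def[of r] norm_radial_stretch powr_powr)
  also have "\<dots> = z"
    using one by (simp add: radial_stretch_def mult.assoc[symmetric])
  finally show ?thesis .
qed simp

text \<open>This makes the abstract inverse in \<open>analysis_op\<close> an explicit stretch with
  exponent at least 1 when p is at most 1.\<close>

lemma inv_radial_stretch:
  assumes "0 < p"
  shows "inv (radial_stretch p) = radial_stretch (1 / p)"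
proof
  show "inv (radial_stretch p) z = radial_stretch (1 / p) z" for z
    using assms
    by (intro inv_f_eq bij_is_inj bij_radial_stretch radial_stretch_inverse) auto
qed

lemma borel_measurable_radial_stretch [measurable]: "radial_stretch q \<in> borel_measurable borel"
  unfolding radial_stretch_def by measurable

text \<open>Splitting off \<open>norm z powr (q - 1) * (z - w)\<close> leaves a remainder that
  depends on the two moduli only, so both regularity estimates below reduce to a real
  inequality.\<close>

lemma norm_radial_stretch_diff_le:
  "norm (radial_stretch q z - radial_stretch q w)
    \<le> norm z powr (q - 1) * norm (z - w) + \<bar>norm z powr (q - 1) * norm w - norm w powr q\<bar>"
proof -
  have "radial_stretch q z - radial_stretch q w
      = of_real (norm z powr (q - 1)) * (z - w) + of_real (norm z powr (q - 1) - norm w powr (q - 1)) * w"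
    by (simp add: radial_stretch_def algebra_simps)
  then have "norm (radial_stretch q z - radial_stretch q w)
      \<le> norm z powr (q - 1) * norm (z - w) + \<bar>norm z powr (q - 1) - norm w powr (q - 1)\<bar> * norm w"
    by (metis norm_triangle_ineq norm_mult norm_of_real abs_of_nonneg powr_ge_zero)
  also have "\<bar>norm z powr (q - 1) - norm w powr (q - 1)\<bar> * norm w
      = \<bar>(norm z powr (q - 1) - norm w powr (q - 1)) * norm w\<bar>"
    by (simp add: abs_mult)
  also have "(norm z powr (q - 1) - norm w powr (q - 1)) * norm w
      = norm z powr (q - 1) * norm w - norm w powr q"
    by (cases "w = 0") (simp_all add: algebra_simps powr_diff)
  finally show ?thesis .
qed

lemma radial_stretch_Hoelder_aux:
  assumes p: "0 < p" "p \<le> 1" and le: "norm w \<le> norm z"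
  shows "norm (radial_stretch p z - radial_stretch p w) \<le> 4 * norm (z - w) powr p"
proof (cases "z = w")
  case False
  define N n D where "N = norm z" and "n = norm w" and "D = norm (z - w)"
  have le': "n \<le> N" "0 \<le> n" "0 < D" "D \<le> 2 * N" "N - n \<le> D"
    using le False norm_triangle_ineq2[of z w] norm_triangle_ineq4[of z w]
    by (auto simp: N_def n_def D_def)
  then have "0 < N"
    by linarith
  \<comment> \<open>As \<open>p - 1\<close> is not positive, \<open>n powr p\<close> lies between
    \<open>N powr (p - 1) * n\<close> and \<open>N powr (p - 1) * N\<close>; the length of this
    interval bounds the modulus term.\<close>
  have "N powr (p - 1) * n \<le> n powr p"
  proof (cases "n = 0")
    case False
    then have "N powr (p - 1) * n \<le> n powr (p - 1) * n"
      using le' p by (intro mult_right_mono powr_mono2') auto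
    then show ?thesis
      using False le' by (simp add: powr_diff)
  qed simp
  moreover have "n powr p \<le> N powr (p - 1) * N"
    using le' p \<open>0 < N\<close> powr_mono2[of p n N] by (simp add: powr_diff)
  moreover have "N powr (p - 1) * (N - n) \<le> N powr (p - 1) * D"
    using le' by (intro mult_left_mono) auto
  ultimately have "\<bar>N powr (p - 1) * n - n powr p\<bar> \<le> N powr (p - 1) * D"
    using le' by (simp add: algebra_simps)
  then have "norm (radial_stretch p z - radial_stretch p w) \<le> 2 * N powr (p - 1) * D"
    using norm_radial_stretch_diff_le[of p z w] by (simp add: N_def n_def D_def)
  \<comment> \<open>Since D is at most 2N and the exponent is not positive, N may be replaced by
    D/2.\<close>
  also have "\<dots> \<le> 2 * (D / 2) powr (p - 1) * D"
    using le' p by (intro mult_right_mono mult_left_mono powr_mono2') auto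
  also have "(D / 2) powr (p - 1) = 2 powr (1 - p) * D powr (p - 1)"
    using le' by (simp add: powr_divide powr_diff)
  \<comment> \<open>Hence the constant 4: one factor 2 counts the two terms of the splitting, the
    other comes from halving D.\<close>
  also have "2 powr (1 - p) \<le> (2 :: real) powr 1"
    using p by (intro powr_mono) auto
  finally show ?thesis
    using le' by (simp add: D_def powr_diff mult_right_mono)
qed simp

lemma radial_stretch_Hoelder:
  assumes "0 < p" "p \<le> 1"
  shows "norm (radial_stretch p z - radial_stretch p w) \<le> 4 * norm (z - w) powr p"
  using radial_stretch_Hoelder_aux[OF assms, of w z] radial_stretch_Hoelder_aux[OF assms, of z w]
  by (metis linear norm_minus_commute)

text \<open>The direct term of the splitting contributes 1 and, by convexity of the power, the
  modulus term contributes \<open>q - 1\<close>; together they give the factor q.\<close>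

lemma radial_stretch_Lipschitz_aux:
  assumes q: "1 \<le> q" and le: "norm w \<le> norm z"
  shows "norm (radial_stretch q z - radial_stretch q w)
    \<le> q * (norm z + norm w) powr (q - 1) * norm (z - w)"
proof (cases "z = 0")
  case False
  define N n D where "N = norm z" and "n = norm w" and "D = norm (z - w)"
  have le': "n \<le> N" "0 \<le> n" "0 < N" "0 \<le> D" "N - n \<le> D"
    using le False norm_triangle_ineq2[of z w] by (auto simp: N_def n_def D_def)
  have "\<bar>N powr (q - 1) * n - n powr q\<bar> \<le> (q - 1) * (N powr (q - 1) * (N - n))"
  proof (cases "n = 0")
    case False
    then have "n > 0"
      using le' by simp
    have "n powr q \<le> N powr (q - 1) * n"
      using le' q \<open>n > 0\<close> powr_mono2[of "q - 1" n N] by (simp add: powr_diff field_simps)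
    \<comment> \<open>Multiplied by q, this instance of Young's inequality says that the power
      function with exponent q lies, at n, above its tangent at N.\<close>
    moreover have "n * N powr (q - 1) \<le> (1 / q) * n powr q + (1 - 1 / q) * N powr q"
      using Youngs_inequality_0[of "1 / q" "1 - 1 / q" "n powr q" "N powr q"] le' q \<open>n > 0\<close>
      by (simp add: powr_powr right_diff_distrib)
    then have "q * (n * N powr (q - 1)) \<le> n powr q + (q - 1) * N powr q"
      using q by (simp add: field_simps)
    moreover have "N powr q = N powr (q - 1) * N"
      using le' by (simp add: powr_diff)
    ultimately show ?thesis
      by (simp add: algebra_simps)
  qed (use le' q in simp)
  also have "\<dots> \<le> (q - 1) * (N powr (q - 1) * D)"
    using le' q by (intro mult_left_mono) auto
  finally have "norm (radial_stretch q z - radial_stretch q w) \<le> q * N powr (q - 1) * D"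
    using norm_radial_stretch_diff_le[of q z w] by (simp add: N_def n_def D_def algebra_simps)
  also have "\<dots> \<le> q * (N + n) powr (q - 1) * D"
    using le' q by (intro mult_right_mono mult_left_mono powr_mono2) auto
  finally show ?thesis
    by (simp add: N_def n_def D_def)
qed (use le in simp)

lemma radial_stretch_Lipschitz:
  assumes "1 \<le> q"
  shows "norm (radial_stretch q z - radial_stretch q w)
    \<le> q * (norm z + norm w) powr (q - 1) * norm (z - w)"
  using radial_stretch_Lipschitz_aux[OF assms, of w z] radial_stretch_Lipschitz_aux[OF assms, of z w]
  by (metis add.commute linear norm_minus_commute)

section \<open>Inequalities for powers\<close>

text \<open>After division by \<open>x + y\<close> both fractions lie in the unit interval, where t
  is at most \<open>t powr p\<close>.\<close>

lemma powr_add_le: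
  fixes x y p :: real
  assumes "0 \<le> x" "0 \<le> y" "0 < p" "p \<le> 1"
  shows "(x + y) powr p \<le> x powr p + y powr p"
proof (cases "x + y = 0")
  case False
  then have pos: "x + y > 0"
    using assms by simp
  have *: "t / (x + y) \<le> (t / (x + y)) powr p" if "0 \<le> t" "t \<le> x + y" for t
    using powr_mono'[of p 1 "t / (x + y)"] that pos assms by simp
  have "1 = x / (x + y) + y / (x + y)"
    using pos by (simp add: add_divide_distrib[symmetric])
  also have "\<dots> \<le> (x / (x + y)) powr p + (y / (x + y)) powr p"
    using *[of x] *[of y] assms by simp
  also have "\<dots> = (x powr p + y powr p) / (x + y) powr p"
    using assms pos by (simp add: powr_divide add_divide_distrib)
  finally show ?thesis
    using pos by (simp add: field_simps)
qed (use assms in simp)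

text \<open>Normalising both sums to 1 reduces the claim, term by term, to the weighted
  arithmetic-geometric mean inequality with weights \<open>1 - p\<close> and p.\<close>

lemma Hoelder_sum:
  fixes x y :: "'a \<Rightarrow> real"
  assumes "finite K" "\<And>k. 0 \<le> x k" "\<And>k. 0 \<le> y k" "0 < p" "p \<le> 1"
  shows "(\<Sum>k\<in>K. x k powr (1 - p) * y k powr p) \<le> (\<Sum>k\<in>K. x k) powr (1 - p) * (\<Sum>k\<in>K. y k) powr p"
proof (cases "(\<Sum>k\<in>K. x k) = 0 \<or> (\<Sum>k\<in>K. y k) = 0")
  case True
  then have "(\<forall>k\<in>K. x k = 0) \<or> (\<forall>k\<in>K. y k = 0)"
    using assms by (simp add: sum_nonneg_eq_0_iff)
  \<comment> \<open>For p = 1 this uses the convention \<open>0 powr 0 = 0\<close>.\<close>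
  then have "(\<Sum>k\<in>K. x k powr (1 - p) * y k powr p) = 0"
    using assms by (intro sum.neutral) auto
  then show ?thesis
    by (simp add: sum_nonneg)
next
  case False
  define X Y where "X = (\<Sum>k\<in>K. x k)" and "Y = (\<Sum>k\<in>K. y k)"
  have pos: "X > 0" "Y > 0"
    using False assms by (auto simp: X_def Y_def less_le sum_nonneg)
  have summand: "x k powr (1 - p) * y k powr p
      \<le> X powr (1 - p) * Y powr p * ((1 - p) * (x k / X) + p * (y k / Y))" for k
  proof (cases "x k = 0 \<or> y k = 0")
    case True
    then show ?thesis
      using assms pos by (auto intro!: mult_nonneg_nonneg add_nonneg_nonneg)
  next
    case False
    then have kpos: "x k > 0" "y k > 0"
      using assms by (simp_all add: less_le)
    have "x k powr (1 - p) * y k powr p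
        = X powr (1 - p) * Y powr p * ((x k / X) powr (1 - p) * (y k / Y) powr p)"
      using kpos pos by (simp add: powr_divide)
    also have "\<dots> \<le> X powr (1 - p) * Y powr p * ((1 - p) * (x k / X) + p * (y k / Y))"
      using kpos pos assms by (intro mult_left_mono Youngs_inequality_0) auto
    finally show ?thesis .
  qed
  have "(\<Sum>k\<in>K. x k powr (1 - p) * y k powr p)
      \<le> (\<Sum>k\<in>K. X powr (1 - p) * Y powr p * ((1 - p) * (x k / X) + p * (y k / Y)))"
    by (intro sum_mono summand)
  also have "\<dots> = X powr (1 - p) * Y powr p * ((1 - p) * (X / X) + p * (Y / Y))"
    by (simp add: sum_distrib_left[symmetric] sum.distrib sum_divide_distrib[symmetric] X_def Y_def)
  also have "\<dots> = X powr (1 - p) * Y powr p"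
    using pos by simp
  finally show ?thesis
    by (simp add: X_def Y_def)
qed

section \<open>Invertible affine substitutions\<close>

lemma invertible_affine_inverse:
  fixes A :: "real^'d^'d"
  assumes "invertible A"
  obtains g where "g differentiable_on UNIV"
    "\<And>x. g (A *v x - c) = x" "\<And>y. A *v g y - c = y"
proof -
  obtain B where B: "A ** B = mat 1" "B ** A = mat 1"
    using assms by (auto simp: invertible_def)
  show thesis
  proof
    show "(\<lambda>y. B *v (y + c)) differentiable_on UNIV"
      unfolding matrix_vector_right_distrib
      by (intro differentiable_on_add differentiable_on_const linear_imp_differentiable_on
          matrix_vector_mul_linear)
    show "B *v (A *v x - c + c) = x" for x
      by (simp add: matrix_vector_mul_assoc B)
    show "A *v (B *v (y + c)) - c = y" for y
      by (simp add: matrix_vector_mul_assoc B)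
  qed
qed

text \<open>Continuity alone handles Borel sets only. A preimage under the affine map is an image
  under its differentiable inverse, and such images of Lebesgue sets are Lebesgue
  measurable.\<close>

lemma measurable_lebesgue_affine:
  fixes A :: "real^'d^'d"
  assumes "invertible A"
  shows "(\<lambda>x. A *v x - c) \<in> lebesgue \<rightarrow>\<^sub>M lebesgue"
proof (rule measurableI)
  fix S :: "(real^'d) set"
  assume S: "S \<in> sets lebesgue"
  obtain g where g: "g differentiable_on UNIV" "\<And>x. g (A *v x - c) = x" "\<And>y. A *v g y - c = y"
    using invertible_affine_inverse[OF assms] by blast
  have "(\<lambda>x. A *v x - c) -` S = g ` S"
  proof (intro set_eqI iffI)
    fix x assume "x \<in> (\<lambda>x. A *v x - c) -` S"
    then show "x \<in> g ` S"
      using g(2)[of x] by (metis imageI vimageD)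
  qed (auto simp: g(3))
  moreover have "g ` S \<in> sets lebesgue"
    using S g(1) by (intro differentiable_image_in_sets_lebesgue) (auto intro: differentiable_on_subset)
  ultimately show "(\<lambda>x. A *v x - c) -` S \<inter> space lebesgue \<in> sets lebesgue"
    by simp
qed simp

lemma AE_lebesgue_affine:
  fixes A :: "real^'d^'d"
  assumes "invertible A" "AE x in lebesgue. P x"
  shows "AE x in lebesgue. P (A *v x - c)"
proof -
  obtain N where N: "negligible N" "{x. \<not> P x} \<subseteq> N"
    using assms(2) by (auto simp: eventually_ae_filter negligible_iff_null_sets)
  obtain g where g: "g differentiable_on UNIV" "\<And>x. g (A *v x - c) = x" "\<And>y. A *v g y - c = y"
    using invertible_affine_inverse[OF assms(1)] by blast
  have "negligible (g ` N)"
    using N(1) g(1) by (intro negligible_differentiable_image_negligible) (auto intro: differentiable_on_subset)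
  moreover have "{x. \<not> P (A *v x - c)} \<subseteq> g ` N"
  proof
    fix x assume "x \<in> {x. \<not> P (A *v x - c)}"
    then have "A *v x - c \<in> N"
      using N(2) by blast
    then show "x \<in> g ` N"
      using g(2)[of x] by (metis imageI)
  qed
  ultimately show ?thesis
    by (auto simp: eventually_ae_filter negligible_iff_null_sets)
qed

section \<open>Function spaces\<close>

lemma Lp_0 [simp]: "(\<lambda>x. 0) \<in> Lp p"
  by (simp add: Lp_def)

lemma d_Lp_eq:
  assumes "p \<noteq> 0"
  shows "d_Lp p f g = (LINT x|lebesgue. norm (f x - g x) powr p)"
  using assms by (simp add: d_Lp_def Lp_norm_def powr_powr)

lemma Lp_diff:
  assumes "0 < p" "p \<le> 1" "f \<in> Lp p" "g \<in> Lp p"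
  shows "(\<lambda>x. f x - g x) \<in> Lp p"
proof -
  have f: "f \<in> borel_measurable lebesgue" "integrable lebesgue (\<lambda>x. norm (f x) powr p)"
    and g: "g \<in> borel_measurable lebesgue" "integrable lebesgue (\<lambda>x. norm (g x) powr p)"
    using assms by (auto simp: Lp_def)
  have m: "(\<lambda>x. f x - g x) \<in> borel_measurable lebesgue"
    using f(1) g(1) by (rule borel_measurable_diff)
  have le: "norm (f x - g x) powr p \<le> norm (f x) powr p + norm (g x) powr p" for x
    by (rule order_trans[OF powr_mono2 powr_add_le]) (use assms norm_triangle_ineq4 in auto)
  have "integrable lebesgue (\<lambda>x. norm (f x - g x) powr p)"
  proof (rule Bochner_Integration.integrable_bound)
    show "integrable lebesgue (\<lambda>x. norm (f x) powr p + norm (g x) powr p)"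
      using f(2) g(2) by (rule Bochner_Integration.integrable_add)
    show "(\<lambda>x. norm (f x - g x) powr p) \<in> borel_measurable lebesgue"
      by (intro powr_real_measurable measurable_compose[OF m] borel_measurable_norm borel_measurable_const)
    show "AE x in lebesgue. norm (norm (f x - g x) powr p) \<le> norm (norm (f x) powr p + norm (g x) powr p)"
      using le by (intro AE_I2) simp
  qed
  with m show ?thesis
    unfolding Lp_def by blast
qed

text \<open>Subadditivity of the p-th power is integrated pointwise. The inequality is used to bound
  distances to 0 in a neighbourhood of a given function.\<close>

lemma d_Lp_triangle:
  fixes f g h :: "real^'d \<Rightarrow> complex"
  assumes "0 < p" "p \<le> 1" "f \<in> Lp p" "g \<in> Lp p" "h \<in> Lp p"
  shows "d_Lp p f h \<le> d_Lp p f g + d_Lp p g h"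
proof -
  have int: "integrable lebesgue (\<lambda>x. norm (u x - v x) powr p)" if "u \<in> Lp p" "v \<in> Lp p" for u v :: "real^'d \<Rightarrow> complex"
    using Lp_diff[OF assms(1,2) that] by (simp add: Lp_def)
  have "norm (f x - h x) powr p \<le> norm (f x - g x) powr p + norm (g x - h x) powr p" for x
    by (rule order_trans[OF powr_mono2 powr_add_le])
      (use assms norm_triangle_ineq[of "f x - g x" "g x - h x"] in auto)
  then have "(LINT x|lebesgue. norm (f x - h x) powr p)
      \<le> (LINT x|lebesgue. norm (f x - g x) powr p + norm (g x - h x) powr p)"
    using assms by (intro integral_mono int Bochner_Integration.integrable_add)
  then show ?thesis
    using assms by (simp add: d_Lp_eq int)
qed

lemma d_Lp_commute: "d_Lp p f g = d_Lp p g f"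
  by (simp add: d_Lp_def Lp_norm_def norm_minus_commute)

lemma d_Lp_nonneg: "0 \<le> d_Lp p f g"
  by (simp add: d_Lp_def)

lemma integrable_radial_stretch:
  assumes "f \<in> Lp p"
  shows "integrable lebesgue (\<lambda>x. radial_stretch p (f x))"
proof -
  have f: "f \<in> borel_measurable lebesgue" "integrable lebesgue (\<lambda>x. norm (f x) powr p)"
    using assms by (auto simp: Lp_def)
  show ?thesis
    using f(2) measurable_compose[OF f(1) borel_measurable_radial_stretch]
    by (rule Bochner_Integration.integrable_bound) (simp add: norm_radial_stretch)
qed

lemma integral_radial_stretch_diff_le:
  assumes "0 < p" "p \<le> 1" "f \<in> Lp p" "g \<in> Lp p"
  shows "(LINT x|lebesgue. norm (radial_stretch p (f x) - radial_stretch p (g x))) \<le> 4 * d_Lp p f g"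
proof -
  have "(LINT x|lebesgue. norm (radial_stretch p (f x) - radial_stretch p (g x)))
      \<le> (LINT x|lebesgue. 4 * norm (f x - g x) powr p)"
    using Lp_diff[OF assms] assms
    by (intro integral_mono integrable_norm Bochner_Integration.integrable_diff
        integrable_radial_stretch integrable_mult_right radial_stretch_Hoelder)
      (auto simp: Lp_def)
  then show ?thesis
    using assms by (simp add: d_Lp_eq)
qed

section \<open>Pairing with a bounded family\<close>

lemma integrable_pairing:
  assumes "integrable lebesgue F" "G \<in> Linf"
  shows "integrable lebesgue (\<lambda>x. F x * cnj (G x))"
proof -
  obtain M where M: "AE x in lebesgue. norm (G x) \<le> M" and G: "G \<in> borel_measurable lebesgue"
    using assms(2) by (auto simp: Linf_def)
  have F: "F \<in> borel_measurable lebesgue"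
    using assms(1) by (rule borel_measurable_integrable)
  have meas: "(\<lambda>x. F x * cnj (G x)) \<in> borel_measurable lebesgue"
    by (intro borel_measurable_times F borel_measurable_continuous_on[of cnj] G continuous_intros)
  show ?thesis
  proof (rule Bochner_Integration.integrable_bound[where f = "\<lambda>x. M * norm (F x)"])
    show "AE x in lebesgue. norm (F x * cnj (G x)) \<le> norm (M * norm (F x))"
      using M
    proof eventually_elim
      case (elim x)
      \<comment> \<open>The sign of M is not given, so the comparison uses its absolute
        value.\<close>
      then have "norm (G x) \<le> \<bar>M\<bar>" by linarith
      then show ?case
        by (simp add: norm_mult abs_mult mult.commute[of _ "norm (F x)"] mult_left_mono)
    qed
  qed (use assms(1) meas in auto)
qed

text \<open>The bound M applies to the whole sum under the integral, not to each term, so it does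
  not grow with K. Finiteness of K makes the interchange plain linearity.\<close>

lemma sum_norm_pairing_le:
  assumes "integrable lebesgue F" "finite K" "\<And>k. G k \<in> Linf"
    and "AE x in lebesgue. (\<Sum>k\<in>K. norm (G k x)) \<le> M"
  shows "(\<Sum>k\<in>K. norm (pairing F (G k))) \<le> M * (LINT x|lebesgue. norm (F x))"
proof -
  have int: "integrable lebesgue (\<lambda>x. norm (F x * cnj (G k x)))" for k
    using assms by (intro integrable_norm integrable_pairing)
  have "(\<Sum>k\<in>K. norm (pairing F (G k))) \<le> (\<Sum>k\<in>K. LINT x|lebesgue. norm (F x * cnj (G k x)))"
    unfolding pairing_def by (intro sum_mono integral_norm_bound)
  also have "\<dots> = (LINT x|lebesgue. (\<Sum>k\<in>K. norm (F x * cnj (G k x))))"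
    using int by (simp add: Bochner_Integration.integral_sum)
  also have "\<dots> \<le> (LINT x|lebesgue. M * norm (F x))"
  proof (rule integral_mono_AE)
    show "AE x in lebesgue. (\<Sum>k\<in>K. norm (F x * cnj (G k x))) \<le> M * norm (F x)"
      using assms(4)
      by eventually_elim
        (simp add: norm_mult sum_distrib_left[symmetric] mult.commute[of M] mult_left_mono)
  qed (use assms int in auto)
  finally show ?thesis
    by simp
qed

lemma pairing_diff:
  assumes "integrable lebesgue F" "integrable lebesgue F'" "G \<in> Linf"
  shows "pairing (\<lambda>x. F x - F' x) G = pairing F G - pairing F' G"
  using integrable_pairing[OF assms(1,3)] integrable_pairing[OF assms(2,3)]
  by (simp add: pairing_def left_diff_distrib)

lemma Linf_affine:
  fixes A :: "real^'d^'d"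
  assumes "\<phi> \<in> Linf" "invertible A"
  shows "(\<lambda>x. \<phi> (A *v x - c)) \<in> Linf"
proof -
  obtain M where M: "AE x in lebesgue. norm (\<phi> x) \<le> M" and m: "\<phi> \<in> borel_measurable lebesgue"
    using assms(1) by (auto simp: Linf_def)
  show ?thesis
    using AE_lebesgue_affine[OF assms(2) M, of c]
      measurable_compose[OF measurable_lebesgue_affine[OF assms(2), of c] m]
    unfolding Linf_def by blast
qed

text \<open>An infinite sum in \<open>ennreal\<close> is the supremum of its finite partial sums,
  and \<open>det b\<close> is nonzero, so dividing the essential bound by its absolute value gives
  one M for all finite K.\<close>

lemma periodization_finite_sum:
  fixes b :: "real^'d^'d" and \<phi> :: "real^'d \<Rightarrow> complex"
  assumes "invertible b" "periodization b (\<lambda>x. ennreal (norm (\<phi> x))) \<in> Linf_ennreal"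
  obtains M where "0 \<le> M"
    "\<And>K. finite K \<Longrightarrow> AE x in lebesgue. (\<Sum>k\<in>K. norm (\<phi> (x - b *v real_vec k))) \<le> M"
proof -
  obtain N where N: "AE x in lebesgue. periodization b (\<lambda>x. ennreal (norm (\<phi> x))) x \<le> ennreal N"
    using assms(2) by (auto simp: Linf_ennreal_def)
  have d: "\<bar>det b\<bar> > 0"
    using assms(1) by (simp add: invertible_det_nz)
  show thesis
  proof
    \<comment> \<open>N may be negative, in which case \<open>ennreal N\<close> is 0; the absolute
      value is a valid bound in every case.\<close>
    show "0 \<le> \<bar>N\<bar> / \<bar>det b\<bar>"
      by simp
    fix K :: "(int^'d) set"
    assume K: "finite K"
    show "AE x in lebesgue. (\<Sum>k\<in>K. norm (\<phi> (x - b *v real_vec k))) \<le> \<bar>N\<bar> / \<bar>det b\<bar>"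
      using N
    proof eventually_elim
      case (elim x)
      let ?f = "\<lambda>k. norm (\<phi> (x - b *v real_vec k))"
      have "ennreal (\<bar>det b\<bar> * sum ?f K) = ennreal \<bar>det b\<bar> * (\<Sum>k\<in>K. ennreal (?f k))"
        by (simp add: ennreal_mult sum_nonneg sum_ennreal)
      also have "\<dots> \<le> ennreal \<bar>det b\<bar> * (\<Sum>\<^sub>\<infinity>k. ennreal (?f k))"
        using K by (intro mult_left_mono)
          (auto simp: nonneg_infsum_complete intro!: SUP_upper)
      also have "\<dots> \<le> ennreal \<bar>N\<bar>"
        using elim by (auto simp: periodization_def intro: order_trans ennreal_leI)
      finally have "\<bar>det b\<bar> * sum ?f K \<le> \<bar>N\<bar>"
        by simp
      then show ?case
        using d by (simp add: field_simps)
    qed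
  qed
qed

section \<open>The analysis operator\<close>

text \<open>In the constant, \<open>\<bar>det b\<bar> / p\<close> comes from the prefactor and the
  Lipschitz factor of the inverse stretch, \<open>M powr (1 - p)\<close> from the sizes of the
  coefficients, and \<open>(4 * M) powr p\<close> from their differences.\<close>

lemma sum_analysis_op_diff_le:
  fixes b A :: "real^'d^'d" and \<phi> :: "real^'d \<Rightarrow> complex"
  assumes p: "0 < p" "p \<le> 1" and "\<phi> \<in> Linf" "invertible A" "finite K" "0 \<le> M"
    and bound: "AE x in lebesgue. (\<Sum>k\<in>K. norm (\<phi> (x - b *v real_vec k))) \<le> M"
    and f: "f \<in> Lp p" and g: "g \<in> Lp p"
  shows "(\<Sum>k\<in>K. norm (analysis_op p b \<phi> A f k - analysis_op p b \<phi> A g k) powr p)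
    \<le> (\<bar>det b\<bar> / p) powr p * M powr (1 - p) * (4 * M) powr p
      * (d_Lp p f (\<lambda>x. 0) + d_Lp p (\<lambda>x. 0) g) powr (1 - p) * d_Lp p f g powr p"
proof -
  define G where "G k x = \<phi> (A *v x - b *v real_vec k)" for k x
  define u where "u k = pairing (\<lambda>x. radial_stretch p (f x)) (G k)" for k
  define v where "v k = pairing (\<lambda>x. radial_stretch p (g x)) (G k)" for k
  have G: "G k \<in> Linf" for k
    unfolding G_def using assms by (intro Linf_affine)
  \<comment> \<open>The lattice shift is subtracted after A has acted, so this is the given bound
    evaluated at \<open>A *v x\<close>.\<close>
  have bound_G: "AE x in lebesgue. (\<Sum>k\<in>K. norm (G k x)) \<le> M"
    unfolding G_def using AE_lebesgue_affine[OF \<open>invertible A\<close> bound, of 0] by simp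
  have sum_le: "(\<Sum>k\<in>K. norm (pairing F (G k))) \<le> M * (LINT x|lebesgue. norm (F x))"
    if "integrable lebesgue F" for F
    using that \<open>finite K\<close> G bound_G by (rule sum_norm_pairing_le)
  have int: "integrable lebesgue (\<lambda>x. radial_stretch p (f x))"
    "integrable lebesgue (\<lambda>x. radial_stretch p (g x))"
    using f g by (auto intro: integrable_radial_stretch)
  have sum_u: "(\<Sum>k\<in>K. norm (u k)) \<le> M * d_Lp p f (\<lambda>x. 0)"
    and sum_v: "(\<Sum>k\<in>K. norm (v k)) \<le> M * d_Lp p (\<lambda>x. 0) g"
    using sum_le[OF int(1)] sum_le[OF int(2)] p
    by (simp_all add: u_def v_def d_Lp_eq norm_radial_stretch)
  have "(\<Sum>k\<in>K. norm (u k - v k))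
      = (\<Sum>k\<in>K. norm (pairing (\<lambda>x. radial_stretch p (f x) - radial_stretch p (g x)) (G k)))"
    using int G by (simp add: u_def v_def pairing_diff)
  also have "\<dots> \<le> M * (LINT x|lebesgue. norm (radial_stretch p (f x) - radial_stretch p (g x)))"
    using int by (intro sum_le Bochner_Integration.integrable_diff)
  also have "\<dots> \<le> M * (4 * d_Lp p f g)"
    using assms by (intro mult_left_mono integral_radial_stretch_diff_le)
  finally have sum_uv: "(\<Sum>k\<in>K. norm (u k - v k)) \<le> 4 * M * d_Lp p f g"
    by simp
  have pointwise: "norm (analysis_op p b \<phi> A f k - analysis_op p b \<phi> A g k) powr p
      \<le> (\<bar>det b\<bar> / p) powr p * ((norm (u k) + norm (v k)) powr (1 - p) * norm (u k - v k) powr p)" for k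
  proof -
    have "norm (analysis_op p b \<phi> A f k - analysis_op p b \<phi> A g k)
        = \<bar>det b\<bar> * norm (radial_stretch (1 / p) (u k) - radial_stretch (1 / p) (v k))"
      using p
      by (simp add: analysis_op_def inv_radial_stretch u_def v_def G_def[abs_def] norm_mult
          right_diff_distrib[symmetric])
    also have "\<dots> \<le> \<bar>det b\<bar> * (1 / p * (norm (u k) + norm (v k)) powr (1 / p - 1) * norm (u k - v k))"
      using p by (intro mult_left_mono radial_stretch_Lipschitz) auto
    also have "\<dots> = (\<bar>det b\<bar> / p) * (norm (u k) + norm (v k)) powr (1 / p - 1) * norm (u k - v k)"
      by simp
    finally have "norm (analysis_op p b \<phi> A f k - analysis_op p b \<phi> A g k) powr p
        \<le> ((\<bar>det b\<bar> / p) * (norm (u k) + norm (v k)) powr (1 / p - 1) * norm (u k - v k)) powr p"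
      using p by (intro powr_mono2) auto
    \<comment> \<open>The exponents combine as \<open>(1 / p - 1) * p = 1 - p\<close>.\<close>
    also have "\<dots> = (\<bar>det b\<bar> / p) powr p * ((norm (u k) + norm (v k)) powr (1 - p) * norm (u k - v k) powr p)"
      using p by (simp only: powr_mult powr_powr) (simp add: left_diff_distrib)
    finally show ?thesis .
  qed
  have "(\<Sum>k\<in>K. norm (analysis_op p b \<phi> A f k - analysis_op p b \<phi> A g k) powr p)
      \<le> (\<bar>det b\<bar> / p) powr p * (\<Sum>k\<in>K. (norm (u k) + norm (v k)) powr (1 - p) * norm (u k - v k) powr p)"
    unfolding sum_distrib_left by (intro sum_mono pointwise)
  also have "\<dots> \<le> (\<bar>det b\<bar> / p) powr p *
      ((\<Sum>k\<in>K. norm (u k) + norm (v k)) powr (1 - p) * (\<Sum>k\<in>K. norm (u k - v k)) powr p)"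
    using assms by (intro mult_left_mono Hoelder_sum) auto
  also have "\<dots> \<le> (\<bar>det b\<bar> / p) powr p *
      ((M * (d_Lp p f (\<lambda>x. 0) + d_Lp p (\<lambda>x. 0) g)) powr (1 - p) * (4 * M * d_Lp p f g) powr p)"
    using p sum_u sum_v sum_uv
    by (intro mult_left_mono mult_mono powr_mono2)
      (auto simp: sum.distrib distrib_left intro!: sum_nonneg add_nonneg_nonneg)
  also have "\<dots> = (\<bar>det b\<bar> / p) powr p * M powr (1 - p) * (4 * M) powr p
      * (d_Lp p f (\<lambda>x. 0) + d_Lp p (\<lambda>x. 0) g) powr (1 - p) * d_Lp p f g powr p"
    using \<open>0 \<le> M\<close> by (simp add: powr_mult d_Lp_nonneg)
  finally show ?thesis .
qed

text \<open>Nonnegative terms with bounded finite sums are summable with the same bound, so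
  estimates over finite K yield both membership and distance.\<close>

lemma d_lp_le_finite_sums:
  assumes "p \<noteq> 0" "\<And>K. finite K \<Longrightarrow> (\<Sum>k\<in>K. norm (s k - t k) powr p) \<le> B"
  shows "(\<lambda>k. s k - t k) \<in> lp p" "d_lp p s t \<le> B"
proof -
  have sum: "(\<lambda>k. norm (s k - t k) powr p) summable_on UNIV"
    using assms(2) by (intro nonneg_bdd_above_summable_on) (auto simp: bdd_above_def)
  then show "(\<lambda>k. s k - t k) \<in> lp p"
    by (simp add: lp_def)
  have "0 \<le> (\<Sum>\<^sub>\<infinity>k. norm (s k - t k) powr p)"
    by (intro infsum_nonneg) simp
  then have "d_lp p s t = (\<Sum>\<^sub>\<infinity>k. norm (s k - t k) powr p)"
    using assms(1) by (simp add: d_lp_def lp_norm_def powr_powr)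
  also have "\<dots> \<le> B"
    using sum assms(2) by (intro infsum_le_finite_sums)
  finally show "d_lp p s t \<le> B" .
qed

lemma analysis_op_0: "0 < p \<Longrightarrow> analysis_op p b \<phi> A (\<lambda>x. 0) = (\<lambda>k. 0)"
  by (simp add: analysis_op_def pairing_def inv_radial_stretch)

text \<open>Near \<open>h\<close> the distances of \<open>f\<close> and \<open>g\<close> to \<open>0\<close> are at most \<open>1 + d_Lp p h 0\<close>, so the
  global estimate has a uniform constant there.\<close>

lemma locally_Hoelder_on_Lp:
  assumes p: "0 < p" "p \<le> 1" and "0 \<le> C"
    and le: "\<And>f g. f \<in> Lp p \<Longrightarrow> g \<in> Lp p \<Longrightarrow>
      d' (T f) (T g) \<le> C * (d_Lp p f (\<lambda>x. 0) + d_Lp p (\<lambda>x. 0) g) powr (1 - p) * d_Lp p f g powr p"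
  shows "locally_Hoelder_on (Lp p) (d_Lp p) d' p T"
  unfolding locally_Hoelder_on_def
proof (intro ballI exI conjI impI)
  fix h f g :: "real^'a \<Rightarrow> complex"
  assume S: "h \<in> Lp p" "f \<in> Lp p" "g \<in> Lp p" and near: "d_Lp p h f < 1" "d_Lp p h g < 1"
  have "d_Lp p f (\<lambda>x. 0) \<le> 1 + d_Lp p h (\<lambda>x. 0)" "d_Lp p (\<lambda>x. 0) g \<le> 1 + d_Lp p h (\<lambda>x. 0)"
    using d_Lp_triangle[OF p S(2,1) Lp_0] d_Lp_triangle[OF p Lp_0 S(1,3)] near
    by (simp_all add: d_Lp_commute)
  then have "(d_Lp p f (\<lambda>x. 0) + d_Lp p (\<lambda>x. 0) g) powr (1 - p)
      \<le> (2 * (1 + d_Lp p h (\<lambda>x. 0))) powr (1 - p)"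
    using p by (intro powr_mono2) (auto simp: d_Lp_nonneg)
  then have "C * (d_Lp p f (\<lambda>x. 0) + d_Lp p (\<lambda>x. 0) g) powr (1 - p) * d_Lp p f g powr p
      \<le> C * (2 * (1 + d_Lp p h (\<lambda>x. 0))) powr (1 - p) * d_Lp p f g powr p"
    using \<open>0 \<le> C\<close> by (intro mult_right_mono mult_left_mono) auto
  then show "d' (T f) (T g) \<le> C * (2 * (1 + d_Lp p h (\<lambda>x. 0))) powr (1 - p) * d_Lp p f g powr p"
    using le[OF S(2,3)] by linarith
qed simp

theorem theorem2:
  fixes p :: real and b :: "real^'d^'d" and \<phi> :: "real^'d \<Rightarrow> complex"
  assumes "0 < p" and "p \<le> 1"
    and "invertible b"
    and "\<phi> \<in> Linf"
    and "periodization b (\<lambda>x. ennreal (norm (\<phi> x))) \<in> Linf_ennreal"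
  shows "\<exists>C::real. \<forall>a :: nat \<Rightarrow> real^'d^'d.
    (\<forall>j>0. invertible (a j)) \<longrightarrow>
    (\<lambda>j. onorm (\<lambda>x. matrix_inv (a j) *v x)) \<longlonglongrightarrow> 0 \<longrightarrow>
    (\<forall>j>0.
      (\<forall>f\<in>Lp p. \<forall>k. integrable lebesgue
        (\<lambda>x. radial_stretch p (f x) * cnj (\<phi> (a j *v x - b *v real_vec k)))) \<and>
      (\<forall>f\<in>Lp p. analysis_op p b \<phi> (a j) f \<in> lp p) \<and>
      locally_Hoelder_on (Lp p) (d_Lp p) (d_lp p) p (analysis_op p b \<phi> (a j)) \<and>
      (\<forall>f\<in>Lp p. \<forall>g\<in>Lp p.
        d_lp p (analysis_op p b \<phi> (a j) f) (analysis_op p b \<phi> (a j) g)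
        \<le> C * (d_Lp p f (\<lambda>x. 0) + d_Lp p (\<lambda>x. 0) g) powr (1 - p) * d_Lp p f g powr p))"
proof -
  obtain M where M: "0 \<le> M"
    "\<And>K. finite K \<Longrightarrow> AE x in lebesgue. (\<Sum>k\<in>K. norm (\<phi> (x - b *v real_vec k))) \<le> M"
    using periodization_finite_sum[OF assms(3,5)] by blast
  \<comment> \<open>Only b, p and M enter, and M depends on b and \<phi>; hence C is fixed before
    the dilations and the scale.\<close>
  define C where "C = (\<bar>det b\<bar> / p) powr p * M powr (1 - p) * (4 * M) powr p"
  show ?thesis
  proof (intro exI[of _ C] allI impI conjI ballI)
    fix a :: "nat \<Rightarrow> real^'d^'d" and j :: nat
    assume "\<forall>j>0. invertible (a j)" "0 < j"
    then have A: "invertible (a j)"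
      by simp
    let ?T = "analysis_op p b \<phi> (a j)"
    have sums: "(\<Sum>k\<in>K. norm (?T f k - ?T g k) powr p)
        \<le> C * (d_Lp p f (\<lambda>x. 0) + d_Lp p (\<lambda>x. 0) g) powr (1 - p) * d_Lp p f g powr p"
      if "f \<in> Lp p" "g \<in> Lp p" "finite K" for f g K
      unfolding C_def using assms A M that by (intro sum_analysis_op_diff_le) auto
    show le: "d_lp p (?T f) (?T g)
        \<le> C * (d_Lp p f (\<lambda>x. 0) + d_Lp p (\<lambda>x. 0) g) powr (1 - p) * d_Lp p f g powr p"
      if "f \<in> Lp p" "g \<in> Lp p" for f g
      using assms(1) sums[OF that] by (intro d_lp_le_finite_sums) auto
    show "locally_Hoelder_on (Lp p) (d_Lp p) (d_lp p) p ?T"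
    proof (rule locally_Hoelder_on_Lp[where C = C])
      show "0 \<le> C"
        by (simp add: C_def)
    qed (fact assms(1,2) le)+
    \<comment> \<open>The operator sends 0 to the zero sequence, so membership is the difference
      estimate with second argument 0.\<close>
    show "?T f \<in> lp p" if "f \<in> Lp p" for f
      using d_lp_le_finite_sums(1)[OF _ sums[OF that Lp_0]] assms(1) by (simp add: analysis_op_0)
    show "integrable lebesgue (\<lambda>x. radial_stretch p (f x) * cnj (\<phi> (a j *v x - b *v real_vec k)))"
      if "f \<in> Lp p" for f k
      using that assms(4) A by (intro integrable_pairing integrable_radial_stretch Linf_affine)
  qed
qed

end
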